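(* There is $\mathcal{F}\subseteq[\mathbb{N}]^{<\omega}$ such that there is no Borel function $S:2^{\mathbb{N}}\to 2^{\mathbb{N}}$ satisfying, for every infinite $x\subseteq\mathbb{N}$, $S(x)\subseteq x$, $S(x)$ infinite, and $S(x)\in hom(\mathcal{F})$.
   Context: Subsets of $\mathbb{N}$ are identified with elements of $2^{\mathbb{N}}$. For finite $s$ and $t\subseteq\mathbb{N}$ (finite or infinite), $s\sqsubseteq t$ ($s$ is an initial segment of $t$) means $s=t\cap\{0,1,\dots,n\}$ for some $n\in\mathbb{N}$. For $\mathcal{F}\subseteq[\mathbb{N}]^{<\omega}$, a set $y\subseteq\mathbb{N}$ is $\mathcal{F}$-homogeneous if either (a) for every infinite $z\subseteq y$ there is $s\in\mathcal{F}$ with $s\sqsubseteq z$, or (b) no finite subset of $y$ belongs to $\mathcal{F}$. $hom(\mathcal{F})$ denotes the set of infinite $\mathcal{F}$-homogeneous sets. *)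

theory Defs
  imports "HOL-Analysis.Analysis"
begin

text \<open>Subsets of nat are identified with points of Cantor space nat => bool
  (product topology of the discrete space bool, from Function_Topology).\<close>

definition initseg :: "nat set \<Rightarrow> nat set \<Rightarrow> bool" where
  "initseg s t \<longleftrightarrow> finite s \<and> (\<exists>n. s = t \<inter> {0..n})"

definition homogeneous :: "nat set set \<Rightarrow> nat set \<Rightarrow> bool" where
  "homogeneous F y \<longleftrightarrow>
     (\<forall>z. z \<subseteq> y \<and> infinite z \<longrightarrow> (\<exists>s\<in>F. initseg s z))
   \<or> (\<forall>s. s \<subseteq> y \<and> finite s \<longrightarrow> s \<notin> F)"

definition hom :: "nat set set \<Rightarrow> nat set set" where
  "hom F = {y. infinite y \<and> homogeneous F y}"

end

theory Submission
  imports Defs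
begin

text \<open>Attach to \<open>p \<in> 2\<^sup>\<nat>\<close> the infinite set \<open>x\<^sub>p\<close> of codes of its initial segments; every
  infinite \<open>y \<subseteq> x\<^sub>p\<close> still computes \<open>p\<close> and, by its sparseness, bounds functions. Read \<open>p\<close> as a
  tree, and let \<open>F\<close> consist of the finite sets which witness that this tree has no branch dominated
  by the set being enumerated. By compactness, an infinite \<open>y \<subseteq> x\<^sub>p\<close> has no finite subset in \<open>F\<close> only
  if some branch is dominated by \<open>y\<close>; conversely, if there is a branch, then \<open>y\<close> has an infinite
  subset dominating it, none of whose initial segments lies in \<open>F\<close>. So a homogeneous \<open>y \<subseteq> x\<^sub>p\<close>
  decides, by a Borel condition on \<open>y\<close>, whether \<open>p\<close> has a branch. A Borel selector would therefore
  make the set of ill-founded trees Borel, contradicting the diagonal argument for analytic sets.\<close>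

section \<open>Analytic sets in Cantor space\<close>

instance bool :: second_countable_topology
proof
  show "\<exists>B::bool set set. countable B \<and> open = generate_topology B"
  proof (intro exI conjI)
    show "countable (UNIV :: bool set set)"
      by (rule countable_finite) simp
    show "open = generate_topology (UNIV :: bool set set)"
      by (auto simp: fun_eq_iff open_discrete intro: generate_topology.Basis)
  qed
qed

lemma tendsto_eventually_coordinatewise:
  fixes g :: "'a \<Rightarrow> 'b \<Rightarrow> 'c::topological_space"
  assumes "\<And>i. \<forall>\<^sub>F n in F. g n i = l i"
  shows "(g \<longlongrightarrow> l) F"
proof -
  have "limitin (product_topology (\<lambda>_. euclidean) UNIV) g l F"
    using assms by (simp add: limitin_componentwise tendsto_eventually)
  then show ?thesis
    unfolding euclidean_product_topology by simp
qed

lemma closed_discrete_set: "closed (A :: 'a::discrete_topology set)"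
  by (simp add: closed_def open_discrete)

definition analytic :: "'a::topological_space set \<Rightarrow> bool" where
  "analytic A \<longleftrightarrow> (\<exists>C::('a \<times> (nat \<Rightarrow> nat)) set. closed C \<and> A = {x. \<exists>f. (x, f) \<in> C})"

lemma closed_imp_analytic: "closed A \<Longrightarrow> analytic A"
  unfolding analytic_def
  by (rule exI[of _ "A \<times> UNIV"]) (auto intro: closed_Times)

lemma analytic_UN:
  assumes "\<And>i::nat. analytic (A i)"
  shows "analytic (\<Union>i. A i)"
proof -
  from assms obtain C where C: "\<And>i. closed (C i)" "\<And>i. A i = {x. \<exists>f::nat \<Rightarrow> nat. (x, f) \<in> C i}"
    unfolding analytic_def by metis
  \<comment> \<open>The first value of the witness selects \<open>i\<close>; its shifted rest is a
    witness for \<open>A i\<close>.\<close>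
  define D where "D = (\<Inter>i. {p. snd p 0 \<noteq> i} \<union> (\<lambda>p. (fst p, \<lambda>k. snd p (Suc k))) -` C i)"
  have "closed D"
    unfolding D_def
  proof (intro closed_INT ballI closed_Un)
    fix i :: nat
    have "closed ((\<lambda>p::'a \<times> (nat \<Rightarrow> nat). snd p 0) -` (- {i}))"
      by (intro closed_vimage continuous_intros closed_discrete_set
        continuous_on_product_then_coordinatewise)
    then show "closed {p::'a \<times> (nat \<Rightarrow> nat). snd p 0 \<noteq> i}"
      by (simp add: vimage_def)
    show "closed ((\<lambda>p. (fst p, \<lambda>k. snd p (Suc k))) -` C i)"
      by (intro closed_vimage C continuous_intros
          continuous_on_product_then_coordinatewise)
  qed
  moreover have "(\<Union>i. A i) = {x. \<exists>f. (x, f) \<in> D}"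
  proof (intro set_eqI iffI)
    fix x assume "x \<in> (\<Union>i. A i)"
    then obtain i f where "(x, f) \<in> C i"
      using C by auto
    then have "(x, case_nat i f) \<in> D"
      by (auto simp: D_def)
    then show "x \<in> {x. \<exists>f. (x, f) \<in> D}"
      by auto
  qed (auto simp: D_def C)
  ultimately show ?thesis
    unfolding analytic_def by blast
qed

lemma analytic_INT:
  assumes "\<And>i::nat. analytic (A i)"
  shows "analytic (\<Inter>i. A i)"
proof -
  from assms obtain C where C: "\<And>i. closed (C i)" "\<And>i. A i = {x. \<exists>f::nat \<Rightarrow> nat. (x, f) \<in> C i}"
    unfolding analytic_def by metis
  \<comment> \<open>One sequence packs witnesses for all \<open>i\<close>, separated by
    \<open>prod_encode\<close>.\<close>
  define D where "D = (\<Inter>i. (\<lambda>p. (fst p, \<lambda>k. snd p (prod_encode (i, k)))) -` C i)"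
  have "closed D"
    unfolding D_def by (intro closed_INT ballI closed_vimage C continuous_intros continuous_on_product_then_coordinatewise)
  moreover have "(\<Inter>i. A i) = {x. \<exists>f. (x, f) \<in> D}"
  proof (intro set_eqI iffI)
    fix x assume "x \<in> (\<Inter>i. A i)"
    then have "\<forall>i. \<exists>f. (x, f) \<in> C i"
      using C by auto
    then obtain g where "\<And>i. (x, g i) \<in> C i"
      by metis
    then have "(x, \<lambda>n. case prod_decode n of (i, k) \<Rightarrow> g i k) \<in> D"
      by (auto simp: D_def)
    then show "x \<in> {x. \<exists>f. (x, f) \<in> D}"
      by auto
  qed (auto simp: D_def C)
  ultimately show ?thesis
    unfolding analytic_def by blast
qed

lemma borel_imp_analytic:
  fixes A :: "(nat \<Rightarrow> bool) set"
  assumes "A \<in> sets borel"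
  shows "analytic A"
proof -
  have "A \<in> sigma_sets UNIV {{f. f i \<in> B} |i B. B \<in> sets (borel :: bool measure)}"
    using assms by (simp add: sets_PiM_equal_borel[symmetric] sets_PiM_single)
  \<comment> \<open>Carrying the complement along lets the induction pass complements; the
    generators are clopen.\<close>
  then have "analytic A \<and> analytic (- A)"
  proof induction
    case (Basic a)
    then obtain i B where a: "a = (\<lambda>f. f i) -` B"
      by (auto simp: vimage_def)
    have "closed a" "closed (- a)"
      unfolding a vimage_Compl[symmetric]
      by (intro closed_vimage continuous_intros closed_discrete_set continuous_on_product_coordinates)+
    then show ?case
      by (simp add: closed_imp_analytic)
  next
    case Empty
    show ?case
      by (simp add: closed_imp_analytic)
  next
    case (Compl a)
    then show ?case
      by (simp add: Compl_eq_Diff_UNIV[symmetric])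
  next
    case (Union a)
    then show ?case
      using analytic_UN[of a] analytic_INT[of "\<lambda>i. - a i"] by simp
  qed
  then show ?thesis ..
qed

section \<open>Trees and the non-Borel set of those with a branch\<close>

text \<open>The set of all \<open>p\<close> with a branch is a diagonal: \<open>p\<close> serves both as the point and as the set
  of nodes, and every analytic set has the form \<open>{x. \<exists>f. \<forall>k. q (node x f k)}\<close> for some \<open>q\<close>.\<close>

definition node :: "(nat \<Rightarrow> bool) \<Rightarrow> (nat \<Rightarrow> nat) \<Rightarrow> nat \<Rightarrow> nat" where
  "node p f k = to_nat (map p [0..<k], map f [0..<k])"

definition branch :: "(nat \<Rightarrow> bool) \<Rightarrow> (nat \<Rightarrow> nat) \<Rightarrow> bool" where
  "branch p f \<longleftrightarrow> (\<forall>k. p (node p f k))"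

lemma node_cong:
  assumes "\<And>i. i < k \<Longrightarrow> p i = q i" "\<And>i. i < k \<Longrightarrow> f i = g i"
  shows "node p f k = node q g k"
proof -
  have "map p [0..<k] = map q [0..<k]" "map f [0..<k] = map g [0..<k]"
    using assms by auto
  then show ?thesis
    unfolding node_def by simp
qed

lemma node_eqD:
  assumes "node p f k = node q g k" "i < k"
  shows "p i = q i" "f i = g i"
  using assms by (auto simp: node_def map_eq_conv)

text \<open>\<open>q\<close> is the tree of initial segments of points of a closed set
  \<open>C\<close>; a pair with all its segments in \<open>q\<close> is a limit of points of
  \<open>C\<close>.\<close>

lemma analytic_eq_branches:
  fixes A :: "(nat \<Rightarrow> bool) set"
  assumes "analytic A"
  obtains q where "\<And>x. x \<in> A \<longleftrightarrow> (\<exists>f. \<forall>k. q (node x f k))"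
proof -
  obtain C where C: "closed C" "A = {x. \<exists>f::nat \<Rightarrow> nat. (x, f) \<in> C}"
    using assms unfolding analytic_def by auto
  define q where "q c \<longleftrightarrow> (\<exists>y g k. (y, g) \<in> C \<and> c = node y g k)" for c
  have "(x, f) \<in> C" if q: "\<forall>k. q (node x f k)" for x f
  proof -
    have "\<exists>y g. (y, g) \<in> C \<and> node x f k = node y g k" for k
    proof -
      from q obtain y g j where *: "(y, g) \<in> C" "node x f k = node y g j"
        unfolding q_def by blast
      then have "map x [0..<k] = map y [0..<j]"
        by (simp add: node_def)
      then have "j = k"
        by (metis length_map length_upt diff_zero)
      with * show ?thesis by blast
    qed
    then obtain y g where yg: "\<And>k. (y k, g k) \<in> C" "\<And>k. node x f k = node (y k) (g k) k"
      by metis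
    have "y \<longlonglongrightarrow> x"
      by (intro tendsto_eventually_coordinatewise eventually_mono[OF eventually_gt_at_top])
        (rule node_eqD(1)[OF yg(2), symmetric])
    moreover have "g \<longlonglongrightarrow> f"
      by (intro tendsto_eventually_coordinatewise eventually_mono[OF eventually_gt_at_top])
        (rule node_eqD(2)[OF yg(2), symmetric])
    ultimately have "(\<lambda>k. (y k, g k)) \<longlonglongrightarrow> (x, f)"
      by (rule tendsto_Pair)
    with C yg show ?thesis
      by (meson closed_sequentially)
  qed
  moreover have "\<forall>k. q (node x f k)" if "(x, f) \<in> C" for x f
    using that unfolding q_def by blast
  ultimately have "(x, f) \<in> C \<longleftrightarrow> (\<forall>k. q (node x f k))" for x f
    by blast
  then show thesis
    using C(2) by (intro that[of q]) simp
qed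

lemma branches_not_borel: "{p. \<exists>f. branch p f} \<notin> sets borel"
proof
  assume "{p. \<exists>f. branch p f} \<in> sets borel"
  then have "- {p. \<exists>f. branch p f} \<in> sets borel"
    by (rule borel_comp)
  then obtain q where q: "\<And>x. x \<in> - {p. \<exists>f. branch p f} \<longleftrightarrow> (\<exists>f. \<forall>k. q (node x f k))"
    using borel_imp_analytic analytic_eq_branches by metis
  \<comment> \<open>At \<open>x = q\<close> the right side says that \<open>q\<close> has a branch,
    the left side that it has none.\<close>
  from q[of q] show False
    unfolding branch_def by blast
qed

section \<open>Sparse codes and dominated branches\<close>

text \<open>Every infinite subset of \<open>range (code p)\<close> determines \<open>p\<close>, since the binary digits of \<open>code p m\<close>
  below the leading one spell out \<open>p\<close> below \<open>m\<close>.\<close>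

definition code :: "(nat \<Rightarrow> bool) \<Rightarrow> nat \<Rightarrow> nat" where
  "code p m = set_encode (insert m {i. i < m \<and> p i})"

lemma set_decode_code: "set_decode (code p m) = insert m {i. i < m \<and> p i}"
  unfolding code_def by (intro set_encode_inverse) simp

lemma code_ge: "2 ^ m \<le> code p m"
proof -
  have "set_encode {m} \<le> code p m"
    by (intro subset_decode_imp_le) (simp add: set_decode_code del: set_encode_insert)
  then show ?thesis by simp
qed

lemma code_less: "code p m < 2 ^ Suc m"
proof -
  have "code p m \<le> set_encode {..<Suc m}"
    by (intro subset_decode_imp_le) (auto simp: set_decode_code)
  also have "\<dots> < 2 ^ Suc m"
    by (simp add: set_encode_def lessThan_atLeast0 sum_power2 del: power_Suc sum.op_ivl_Suc)
  finally show ?thesis .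
qed

lemma code_mono: "strict_mono (code p)"
  unfolding strict_mono_Suc_iff
  using code_ge code_less order.strict_trans1 by (metis order.strict_trans2)

text \<open>For \<open>n \<in> y\<close>, the position of \<open>n\<close> in the increasing
  enumeration of \<open>y\<close>, from 0; counting covers finite \<open>y\<close> too.\<close>

definition index_in :: "nat set \<Rightarrow> nat \<Rightarrow> nat" where
  "index_in y n = card {j \<in> y. j < n}"

text \<open>For \<open>n = code p m\<close>, membership in \<open>set_decode n\<close> agrees with \<open>p\<close> below \<open>m\<close>, and
  \<open>2 ^ Suc c \<le> n\<close> says \<open>c < m\<close>. So \<open>good y f\<close> asks that \<open>f\<close> is dominated by \<open>y\<close> and satisfies those
  instances of \<open>branch p f\<close> that can already be read off the elements of \<open>y\<close>; the bound on \<open>k\<close>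
  makes the condition at the \<open>i\<close>-th element depend on \<open>f\<close> only up to \<open>i\<close>.\<close>

definition good :: "nat set \<Rightarrow> (nat \<Rightarrow> nat) \<Rightarrow> bool" where
  "good y f \<longleftrightarrow> (\<forall>n\<in>y. f (index_in y n) \<le> n \<and>
     (\<forall>k\<le>index_in y n. let c = node (\<lambda>i. i \<in> set_decode n) f k in 2 ^ Suc c \<le> n \<longrightarrow> c \<in> set_decode n))"

lemma index_in_strict_mono_image:
  assumes "strict_mono h" "\<And>i. i < n \<Longrightarrow> i \<in> I"
  shows "index_in (h ` I) (h n) = n"
proof -
  have "{j \<in> h ` I. j < h n} = h ` {..<n}"
    using assms by (auto simp: strict_mono_less)
  then show ?thesis
    using assms by (simp add: index_in_def card_image strict_mono_imp_inj_on inj_on_subset)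
qed

text \<open>Ensures that every \<open>k\<close> tested at \<open>code p m\<close> is at most
  \<open>m\<close>, so that the digits of \<open>code p m\<close> determine the
  \<open>p\<close>-part of the node.\<close>

lemma index_in_le_code:
  assumes "y \<subseteq> range (code p)"
  shows "index_in y (code p m) \<le> m"
proof -
  have "{j \<in> y. j < code p m} \<subseteq> code p ` {..<m}"
    using assms code_mono[of p] by (auto simp: strict_mono_less)
  then have "index_in y (code p m) \<le> card (code p ` {..<m})"
    unfolding index_in_def by (intro card_mono) auto
  also have "\<dots> \<le> m"
    using card_image_le[of "{..<m}" "code p"] by simp
  finally show ?thesis .
qed

lemma node_decode_code: "k \<le> m \<Longrightarrow> node (\<lambda>i. i \<in> set_decode (code p m)) f k = node p f k"
  by (intro node_cong) (auto simp: set_decode_code)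

lemma branch_imp_good:
  assumes "branch p f" "y \<subseteq> range (code p)" "\<And>n. n \<in> y \<Longrightarrow> f (index_in y n) \<le> n"
  shows "good y f"
  unfolding good_def Let_def
proof (intro ballI conjI allI impI)
  fix n k
  assume n: "n \<in> y" and k: "k \<le> index_in y n"
    and le: "2 ^ Suc (node (\<lambda>i. i \<in> set_decode n) f k) \<le> n"
  obtain m where m: "n = code p m"
    using n assms by auto
  have eq: "node (\<lambda>i. i \<in> set_decode n) f k = node p f k"
    using index_in_le_code[OF assms(2), of m] k m node_decode_code by simp
  have "2 ^ Suc (node p f k) < (2::nat) ^ Suc m"
    using le[unfolded eq] code_less[of p m] unfolding m by (rule le_less_trans)
  then have "node p f k < m"
    by simp
  then show "node (\<lambda>i. i \<in> set_decode n) f k \<in> set_decode n"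
    using assms(1) unfolding eq unfolding m set_decode_code branch_def by simp
qed (use assms in auto)

lemma good_imp_branch:
  assumes "good y f" "y \<subseteq> range (code p)" "infinite y"
  shows "branch p f"
  unfolding branch_def
proof
  fix k
  \<comment> \<open>Position at least \<open>k\<close> admits \<open>k\<close> to the test; the
    power, bounded by the element itself, meets the guard in \<open>good\<close> and puts the node
    below the leading digit \<open>m\<close>.\<close>
  let ?h = "enumerate y" and ?N = "k + 2 ^ Suc (Suc (node p f k))"
  have h: "strict_mono ?h" "range ?h = y"
    using assms range_enumerate by (auto simp: strict_mono_def)
  then have N: "?h ?N \<in> y" "index_in y (?h ?N) = ?N"
    using index_in_strict_mono_image[of ?h ?N UNIV] by auto
  obtain m where m: "?h ?N = code p m"
    using N assms by auto
  have km: "k \<le> m"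
    using index_in_le_code[OF assms(2), of m] N m by simp
  have ge: "?N \<le> ?h ?N"
    using assms(3) by (rule le_enumerate)
  then have "2 ^ Suc (Suc (node p f k)) \<le> ?h ?N"
    by (rule add_leD2)
  then have "2 ^ Suc (Suc (node p f k)) < (2::nat) ^ Suc m"
    using code_less[of p m] unfolding m by (rule le_less_trans)
  then have "Suc (Suc (node p f k)) < Suc m"
    by (rule power_less_imp_less_exp[rotated]) simp
  then have "node p f k < m"
    by simp
  moreover have "node p f k \<in> set_decode (?h ?N)"
  proof -
    have "2 ^ Suc (node p f k) \<le> ?h ?N"
      using ge by simp
    moreover have "k \<le> index_in y (?h ?N)"
      using N by simp
    ultimately show ?thesis
      using assms(1) N(1) node_decode_code[OF km, of p f] unfolding good_def m Let_def by metis
  qed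
  ultimately show "p (node p f k)"
    unfolding m set_decode_code by auto
qed

lemma infinite_subset_dominating:
  fixes f :: "nat \<Rightarrow> nat"
  assumes "infinite y"
  obtains z where "z \<subseteq> y" "infinite z" "\<And>n. n \<in> z \<Longrightarrow> f (index_in z n) \<le> n"
proof -
  \<comment> \<open>An element is at least its position in \<open>y\<close>, here at least
    \<open>f i\<close>; partial sums keep \<open>h\<close> increasing.\<close>
  define h where "h i = enumerate y (i + (\<Sum>j\<le>i. f j))" for i
  have h: "strict_mono h"
    unfolding strict_mono_Suc_iff h_def using assms by simp
  show thesis
  proof
    show "range h \<subseteq> y"
      using assms enumerate_in_set by (auto simp: h_def)
    show "infinite (range h)"
      using h by (simp add: range_inj_infinite strict_mono_imp_inj_on)
    fix n assume "n \<in> range h"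
    then obtain i where i: "n = h i" by auto
    have "f i \<le> (\<Sum>j\<le>i. f j)"
      by (intro member_le_sum) auto
    also have "\<dots> \<le> h i"
      unfolding h_def using le_enumerate[OF assms, of "i + (\<Sum>j\<le>i. f j)"] by simp
    finally show "f (index_in (range h) n) \<le> n"
      using h i index_in_strict_mono_image[of h i UNIV] by simp
  qed
qed

text \<open>The condition at \<open>n\<close> involves only elements up to \<open>n\<close>.
  Arbitrary subsets could change \<open>index_in\<close>.\<close>

lemma good_initseg:
  assumes "good z f" "initseg s z"
  shows "good s f"
proof -
  obtain N where s: "s = z \<inter> {0..N}"
    using assms by (auto simp: initseg_def)
  have "index_in s n = index_in z n" if "n \<in> s" for n
  proof -
    have "{j \<in> s. j < n} = {j \<in> z. j < n}"
      using that s by auto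
    then show ?thesis by (simp add: index_in_def)
  qed
  then show ?thesis
    using assms s unfolding good_def by auto
qed

section \<open>Compactness and homogeneity\<close>

lemma bounded_local_compactness:
  fixes R :: "nat \<Rightarrow> (nat \<Rightarrow> nat) \<Rightarrow> bool"
  assumes local: "\<And>i f g. (\<And>j. j \<le> i \<Longrightarrow> f j = g j) \<Longrightarrow> R i f \<Longrightarrow> R i g"
    and bounded: "\<And>i f. R i f \<Longrightarrow> f i \<le> h i"
    and fin: "\<And>m. \<exists>f. \<forall>i<m. R i f"
  obtains f where "\<And>i. R i f"
proof -
  \<comment> \<open>As in Koenig's lemma: \<open>g\<close> below \<open>n\<close> extends to
    solutions of arbitrarily many conditions, and \<open>h\<close> bounds the branching.\<close>
  define E where "E n g \<longleftrightarrow> (\<forall>m. \<exists>f. (\<forall>i<n. f i = g i) \<and> (\<forall>i<m. R i f))" for n g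
  have step: "\<exists>g'. E (Suc n) g' \<and> (\<forall>i<n. g' i = g i)" if E: "E n g" for n g
  proof (rule ccontr)
    assume no: "\<not> ?thesis"
    have "\<exists>m. \<forall>f. (\<forall>i<Suc n. f i = (g(n := v)) i) \<longrightarrow> \<not> (\<forall>i<m. R i f)" for v
    proof -
      have "\<not> E (Suc n) (g(n := v))"
        using no by auto
      then show ?thesis
        unfolding E_def by blast
    qed
    then obtain M where M: "\<And>v f. (\<forall>i<Suc n. f i = (g(n := v)) i) \<Longrightarrow> \<not> (\<forall>i<M v. R i f)"
      by metis
    \<comment> \<open>Exceeds \<open>n\<close>, so that \<open>R n\<close> bounds
      \<open>f n\<close>, and is at least \<open>M v\<close> for each possible value
      \<open>v\<close>.\<close>
    define m where "m = Suc n + (\<Sum>v\<le>h n. M v)"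
    obtain f where f: "\<forall>i<n. f i = g i" "\<forall>i<m. R i f"
      using E unfolding E_def by blast
    have "f n \<le> h n"
      using f(2) by (intro bounded) (simp add: m_def)
    then have "M (f n) \<le> (\<Sum>v\<le>h n. M v)"
      by (intro member_le_sum) auto
    then have "\<forall>i<M (f n). R i f"
      using f(2) by (simp add: m_def)
    moreover have "\<forall>i<Suc n. f i = (g(n := f n)) i"
      using f(1) by (simp add: less_Suc_eq)
    ultimately show False
      using M by blast
  qed
  have "E 0 (\<lambda>_. 0)"
    using fin by (simp add: E_def)
  then obtain G where G: "\<And>n. E n (G n)" "\<And>n i. i < n \<Longrightarrow> G (Suc n) i = G n i"
    using dependent_nat_choice[of E "\<lambda>n g g'. \<forall>i<n. g' i = g i"] step by metis
  have stable: "G (Suc i + d) i = G (Suc i) i" for i d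
    by (induction d) (auto simp: G)
  \<comment> \<open>The diagonal agrees with \<open>G (Suc i)\<close> up to \<open>i\<close>, which
    is all that \<open>R i\<close> sees.\<close>
  have "R i (\<lambda>j. G (Suc j) j)" for i
  proof -
    obtain f where f: "\<forall>j<Suc i. f j = G (Suc i) j" "\<forall>j<Suc i. R j f"
      using G(1)[of "Suc i"] unfolding E_def by blast
    have "f j = G (Suc j) j" if "j \<le> i" for j
      using f(1) that stable[of j "i - j"] by simp
    with f(2) show ?thesis
      using local[of i f] by simp
  qed
  then show thesis by (rule that)
qed

lemma good_compactness:
  assumes "infinite y" and fin: "\<And>s. s \<subseteq> y \<Longrightarrow> finite s \<Longrightarrow> \<exists>f. good s f"
  obtains f where "good y f"
proof -
  let ?h = "enumerate y"
  have h: "strict_mono ?h" "range ?h = y"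
    using assms range_enumerate by (auto simp: strict_mono_def)
  define R where "R i f \<longleftrightarrow> f i \<le> ?h i \<and>
    (\<forall>k\<le>i. let c = node (\<lambda>i'. i' \<in> set_decode (?h i)) f k in 2 ^ Suc c \<le> ?h i \<longrightarrow> c \<in> set_decode (?h i))"
    for i f
  \<comment> \<open>Downward closure of \<open>I\<close> makes ranks in the image equal to indices;
    this covers finite initial pieces and all of \<open>y\<close>.\<close>
  have good_iff: "good (?h ` I) f \<longleftrightarrow> (\<forall>i\<in>I. R i f)" if "\<And>i j. i \<in> I \<Longrightarrow> j < i \<Longrightarrow> j \<in> I" for I f
    using index_in_strict_mono_image[OF h(1)] that by (simp add: good_def R_def)
  obtain f where "\<And>i. R i f"
  proof (rule bounded_local_compactness[of R ?h])
    fix i and f g :: "nat \<Rightarrow> nat"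
    assume eq: "\<And>j. j \<le> i \<Longrightarrow> f j = g j" and "R i f"
    moreover have "node q f k = node q g k" if "k \<le> i" for q k
      using eq that by (intro node_cong) auto
    ultimately show "R i g"
      by (simp add: R_def)
  next
    fix m
    have "\<exists>f. good (?h ` {..<m}) f"
      using h(2) by (intro fin) auto
    then show "\<exists>f. \<forall>i<m. R i f"
      by (subst (asm) good_iff) auto
  qed (auto simp: R_def)
  then show thesis
    using good_iff[of UNIV f] h(2) that by auto
qed

text \<open>\<open>p\<close> does not occur: \<open>good\<close> reads it off the elements, so one
  family serves all \<open>p\<close>.\<close>

definition bad_sets :: "nat set set" where
  "bad_sets = {s. finite s \<and> (\<nexists>f. good s f)}"

text \<open>A branch refutes the first alternative of homogeneity through a subset dominating it,
  leaving the second. The converse is compactness.\<close>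

lemma homogeneous_bad_sets_iff_branch:
  assumes "y \<subseteq> range (code p)" "infinite y" "homogeneous bad_sets y"
  shows "(\<exists>f. branch p f) \<longleftrightarrow> (\<forall>s\<in>bad_sets. \<not> s \<subseteq> y)"
proof
  assume "\<exists>f. branch p f"
  then obtain f where f: "branch p f" ..
  obtain z where z: "z \<subseteq> y" "infinite z" "\<And>n. n \<in> z \<Longrightarrow> f (index_in z n) \<le> n"
    using infinite_subset_dominating[OF assms(2)] by blast
  have "good z f"
    using z assms(1) by (intro branch_imp_good[OF f]) auto
  then have "\<not> (\<exists>s\<in>bad_sets. initseg s z)"
    using good_initseg by (auto simp: bad_sets_def)
  with assms(3) z(1,2) have "\<forall>s. s \<subseteq> y \<and> finite s \<longrightarrow> s \<notin> bad_sets"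
    unfolding homogeneous_def by metis
  then show "\<forall>s\<in>bad_sets. \<not> s \<subseteq> y"
    by (auto simp: bad_sets_def)
next
  assume "\<forall>s\<in>bad_sets. \<not> s \<subseteq> y"
  then have "\<exists>f. good s f" if "s \<subseteq> y" "finite s" for s
    using that by (auto simp: bad_sets_def)
  then obtain f where "good y f"
    using good_compactness[OF assms(2)] by metis
  then show "\<exists>f. branch p f"
    using good_imp_branch assms by blast
qed

section \<open>Borel measurability and the selector\<close>

lemma measurable_pred_coordinate:
  fixes g :: "'a \<Rightarrow> 'b \<Rightarrow> bool"
  assumes "g \<in> borel_measurable M"
  shows "Measurable.pred M (\<lambda>x. g x i)"
proof -
  have "(\<lambda>h::'b \<Rightarrow> bool. h i) \<in> borel_measurable borel"
    by (intro borel_measurable_continuous_onI continuous_on_product_coordinates)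
  then have "(\<lambda>x. g x i) \<in> borel_measurable M"
    by (rule measurable_compose[OF assms])
  then show ?thesis
    by (simp add: measurable_cong_sets[OF refl sets_borel_eq_count_space])
qed

lemma measurable_range_code: "(\<lambda>p n. n \<in> range (code p)) \<in> borel_measurable borel"
proof (rule measurable_coordinatewise_then_product)
  fix n
  have [measurable]: "Measurable.pred borel (\<lambda>p::nat \<Rightarrow> bool. p i)" for i
    by (intro measurable_pred_coordinate) simp
  \<comment> \<open>Comparing binary digits leaves countable quantifiers over coordinates of
    \<open>p\<close>.\<close>
  have "n \<in> range (code p) \<longleftrightarrow> (\<exists>m. \<forall>i. i \<in> set_decode n \<longleftrightarrow> i = m \<or> i < m \<and> p i)" for p
  proof -
    have "n = code p m \<longleftrightarrow> set_decode n = insert m {i. i < m \<and> p i}" for m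
      by (metis set_decode_code set_decode_inverse)
    then show ?thesis
      by (auto simp: set_eq_iff)
  qed
  moreover have "Measurable.pred borel (\<lambda>p. \<exists>m. \<forall>i. i \<in> set_decode n \<longleftrightarrow> i = m \<or> i < m \<and> p i)"
    by measurable
  ultimately show "(\<lambda>p. n \<in> range (code p)) \<in> borel_measurable borel"
    by (simp add: measurable_cong_sets[OF refl sets_borel_eq_count_space])
qed

theorem mainTheorem3:
  shows "\<exists>F :: nat set set. (\<forall>s\<in>F. finite s) \<and>
    \<not> (\<exists>S :: (nat \<Rightarrow> bool) \<Rightarrow> (nat \<Rightarrow> bool).
          S \<in> borel_measurable borel \<and>
          (\<forall>x. infinite {n. x n} \<longrightarrow>
               {n. S x n} \<subseteq> {n. x n} \<and> infinite {n. S x n} \<and> {n. S x n} \<in> hom F))"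
proof (intro exI conjI notI)
  show "\<forall>s\<in>bad_sets. finite s"
    by (simp add: bad_sets_def)
  assume "\<exists>S :: (nat \<Rightarrow> bool) \<Rightarrow> (nat \<Rightarrow> bool).
          S \<in> borel_measurable borel \<and>
          (\<forall>x. infinite {n. x n} \<longrightarrow>
               {n. S x n} \<subseteq> {n. x n} \<and> infinite {n. S x n} \<and> {n. S x n} \<in> hom bad_sets)"
  then obtain S :: "(nat \<Rightarrow> bool) \<Rightarrow> (nat \<Rightarrow> bool)" where S: "S \<in> borel_measurable borel"
    and sel: "\<And>x. infinite {n. x n} \<Longrightarrow>
      {n. S x n} \<subseteq> {n. x n} \<and> infinite {n. S x n} \<and> {n. S x n} \<in> hom bad_sets"
    by blast
  define T where "T p = S (\<lambda>n. n \<in> range (code p))" for p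
  have T: "T \<in> borel_measurable borel"
    unfolding T_def by (rule measurable_compose[OF measurable_range_code S])
  have "(\<exists>f. branch p f) \<longleftrightarrow> (\<forall>s\<in>bad_sets. \<not> s \<subseteq> {n. T p n})" for p
  proof (rule homogeneous_bad_sets_iff_branch)
    have "infinite (range (code p))"
      using code_mono by (simp add: range_inj_infinite strict_mono_imp_inj_on)
    then show "{n. T p n} \<subseteq> range (code p)" "infinite {n. T p n}" "homogeneous bad_sets {n. T p n}"
      using sel[of "\<lambda>n. n \<in> range (code p)"] by (simp_all add: T_def hom_def)
  qed
  then have "{p. \<exists>f. branch p f} = {p. \<forall>s\<in>bad_sets. \<not> (\<forall>n\<in>s. T p n)}"
    by (simp add: subset_eq)
  moreover have "{p. \<forall>s\<in>bad_sets. \<not> (\<forall>n\<in>s. T p n)} \<in> sets borel"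
  proof -
    note [measurable] = measurable_pred_coordinate[OF T]
    \<comment> \<open>Makes the condition a countable intersection of Borel conditions.\<close>
    have "countable bad_sets"
      by (rule countable_subset[OF _ countable_Collect_finite]) (auto simp: bad_sets_def)
    then have "Measurable.pred borel (\<lambda>p. \<forall>s\<in>bad_sets. \<not> (\<forall>n\<in>s. T p n))"
      by measurable
    then show ?thesis
      by (simp add: pred_def)
  qed
  ultimately show False
    using branches_not_borel by simp
qed

end
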